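(* Let $d\ge1$, let $\mathbf{r}=(r_0,\ldots,r_{d-1})\in\mathrm{int}(\mathcal{D}_d)$ be reduced, i.e. $r_0\ne0$, and let $\mathbf{x}\in\mathbb{Z}^d$. The SRS tile $\mathcal{T}_\mathbf{r}(\mathbf{x})$ can be written as $$\mathcal{T}_\mathbf{r}(\mathbf{x})=\mathrm{Lim}_{n\to\infty}M_\mathbf{r}^n\tau_\mathbf{r}^{-n}(\mathbf{x}),$$ where $\mathrm{Lim}$ denotes the limit with respect to the Hausdorff metric (in particular, this limit exists). It is a non-empty compact set that satisfies the set equation $$\mathcal{T}_\mathbf{r}(\mathbf{x})=\bigcup_{\mathbf{y}\in\tau_\mathbf{r}^{-1}(\mathbf{x})}M_\mathbf{r}\mathcal{T}_\mathbf{r}(\mathbf{y}).$$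
   Context: For $\mathbf{r}=(r_0,\ldots,r_{d-1})\in\mathbb{R}^d$ and $\mathbf{z}=(z_0,\ldots,z_{d-1})^t\in\mathbb{Z}^d$ put $\mathbf{r}\mathbf{z}=\sum_i r_iz_i$ and $\tau_\mathbf{r}(\mathbf{z})=(z_1,\ldots,z_{d-1},-\lfloor\mathbf{r}\mathbf{z}\rfloor)^t$, a map $\mathbb{Z}^d\to\mathbb{Z}^d$; $\tau_\mathbf{r}^{-n}(\mathbf{x})=\{\mathbf{z}\in\mathbb{Z}^d\mid\tau_\mathbf{r}^n(\mathbf{z})=\mathbf{x}\}$. $\mathcal{D}_d$ is the set of $\mathbf{r}\in\mathbb{R}^d$ such that $(\tau_\mathbf{r}^n(\mathbf{z}))_{n}$ is eventually periodic for all $\mathbf{z}\in\mathbb{Z}^d$. The companion matrix $M_\mathbf{r}\in\mathbb{R}^{d\times d}$ has last row $(-r_0,\ldots,-r_{d-1})$, entries $1$ on the superdiagonal of the first $d-1$ rows, and $0$ elsewhere (for $d=1$, $M_\mathbf{r}=(-r_0)$). It is a known fact that $\mathbf{r}\in\mathrm{int}(\mathcal{D}_d)$ if and only if $M_\mathbf{r}$ has spectral radius $<1$. The SRS tile of $\mathbf{x}\in\mathbb{Z}^d$ is defined as $\mathcal{T}_\mathbf{r}(\mathbf{x})=\mathrm{Li}_{n\to\infty}M_\mathbf{r}^n\tau_\mathbf{r}^{-n}(\mathbf{x})$, where the lower Hausdorff limit $\mathrm{Li}_{n\to\infty}A_n$ is the set of all $\mathbf{t}\in\mathbb{R}^d$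 such that each neighbourhood of $\mathbf{t}$ intersects $A_n$ for all sufficiently large $n$. The Hausdorff metric on non-empty compact subsets of $\mathbb{R}^d$ is the one induced by a norm on $\mathbb{R}^d$ (convergence does not depend on the norm). *)

theory Defs
  imports "HOL-Analysis.Analysis"
begin

text \<open>Vectors of dimension $d \ge 1$ are indexed by an arbitrary finite linearly ordered type of
  cardinality $d$ (for instance the numeral types). Its elements, listed in increasing order, play
  the role of the indices $0, \ldots, d-1$.\<close>

definition first_ix :: "'n::{finite,linorder}" where
  "first_ix = Min UNIV"

definition last_ix :: "'n::{finite,linorder}" where
  "last_ix = Max UNIV"

text \<open>Only meaningful for indices other than \<^const>\<open>last_ix\<close>.\<close>
definition next_ix :: "'n::{finite,linorder} \<Rightarrow> 'n" where
  "next_ix i = Min {j. i < j}"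

definition real_vec :: "int^'n \<Rightarrow> real^'n" where
  "real_vec z = (\<chi> i. real_of_int (z $ i))"

definition srs_map :: "real^('n::{finite,linorder}) \<Rightarrow> int^('n::{finite,linorder}) \<Rightarrow> int^('n::{finite,linorder})" where
  "srs_map r z = (\<chi> i. if i = last_ix then - \<lfloor>r \<bullet> real_vec z\<rfloor> else z $ next_ix i)"

definition srs_preimage :: "real^('n::{finite,linorder}) \<Rightarrow> nat \<Rightarrow> int^('n::{finite,linorder}) \<Rightarrow> (int^('n::{finite,linorder})) set" where
  "srs_preimage r n x = {z. (srs_map r ^^ n) z = x}"

definition eventually_periodic :: "(nat \<Rightarrow> 'a) \<Rightarrow> bool" where
  "eventually_periodic s \<longleftrightarrow> (\<exists>m. \<exists>p>0. \<forall>n\<ge>m. s (n + p) = s n)"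

definition srs_D :: "(real^('n::{finite,linorder})) set" where
  "srs_D = {r. \<forall>z. eventually_periodic (\<lambda>n. (srs_map r ^^ n) z)}"

definition companion_mat :: "real^('n::{finite,linorder}) \<Rightarrow> real^('n::{finite,linorder})^('n::{finite,linorder})" where
  "companion_mat r =
     (\<chi> i j. if i = last_ix then - (r $ j) else if j = next_ix i then 1 else 0)"

text \<open>The library's \<open>^\<close> on vectors of vectors is the power with respect to
  componentwise multiplication, not the matrix power.\<close>
definition mat_power :: "real^'n^'n \<Rightarrow> nat \<Rightarrow> real^'n^'n" where
  "mat_power M n = (((**) M) ^^ n) (mat 1)"

definition lower_hausdorff_lim :: "(nat \<Rightarrow> 'a::topological_space set) \<Rightarrow> 'a set" where
  "lower_hausdorff_lim A =
     {t. \<forall>U. open U \<and> t \<in> U \<longrightarrow> (\<forall>\<^sub>F n in sequentially. U \<inter> A n \<noteq> {})}"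

definition srs_approx :: "real^('n::{finite,linorder}) \<Rightarrow> int^('n::{finite,linorder}) \<Rightarrow> nat \<Rightarrow> (real^('n::{finite,linorder})) set" where
  "srs_approx r x n = (\<lambda>z. mat_power (companion_mat r) n *v real_vec z) ` srs_preimage r n x"

definition srs_tile :: "real^('n::{finite,linorder}) \<Rightarrow> int^('n::{finite,linorder}) \<Rightarrow> (real^('n::{finite,linorder})) set" where
  "srs_tile r x = lower_hausdorff_lim (srs_approx r x)"

text \<open>The Hausdorff metric for the Euclidean norm; it is only a metric on the non-empty compact
  sets, so convergence below requires all sets involved to be such.\<close>
definition hausdorff_dist :: "'a::metric_space set \<Rightarrow> 'a set \<Rightarrow> real" where
  "hausdorff_dist A B = max (SUP a\<in>A. infdist a B) (SUP b\<in>B. infdist b A)"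

definition has_hausdorff_lim :: "(nat \<Rightarrow> 'a::metric_space set) \<Rightarrow> 'a set \<Rightarrow> bool" where
  "has_hausdorff_lim A T \<longleftrightarrow>
     (\<forall>n. A n \<noteq> {} \<and> compact (A n)) \<and> T \<noteq> {} \<and> compact T \<and>
     (\<lambda>n. hausdorff_dist (A n) T) \<longlonglongrightarrow> 0"

end

theory Submission
  imports Defs "HOL-Computational_Algebra.Fundamental_Theorem_Algebra"
begin

text \<open>If \<open>r\<close> is in the interior of \<open>srs_D\<close>, then the powers of the companion matrix decay
  geometrically: a root \<open>c\<close> of its characteristic polynomial with \<open>norm c > 1\<close> would produce an
  unbounded orbit, rescaling the roots improves this to \<open>norm c < \<rho>\<close> for some \<open>\<rho> < 1\<close>, and a linear
  recurrence whose characteristic roots are smaller than \<open>\<rho>\<close> has only solutions of size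
  \<open>O(\<rho>^n)\<close>. Since the companion matrix inverts the map on preimages up to a multiple in \<open>[0, 1)\<close> of
  the last unit vector, consecutive approximations of a tile have Hausdorff distance \<open>O(\<rho>^n)\<close>.
  So they form a Cauchy sequence, whose limit is the lower Hausdorff limit; the set equation
  is the limit of the corresponding equation for the approximations.\<close>

section \<open>Polynomials in the shift operator\<close>

text \<open>With \<open>E\<close> the shift operator on sequences, this is the sequence
  \<open>p(E) s\<close> at position \<open>n\<close>.\<close>

definition shift_poly :: "complex poly \<Rightarrow> (nat \<Rightarrow> complex) \<Rightarrow> nat \<Rightarrow> complex" where
  "shift_poly p s n = (\<Sum>i\<le>degree p. coeff p i * s (n + i))"

lemma shift_poly_altdef:
  assumes "degree p \<le> N"
  shows "shift_poly p s n = (\<Sum>i\<le>N. coeff p i * s (n + i))"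
  unfolding shift_poly_def
  by (rule sum.mono_neutral_left) (use assms in \<open>auto simp: coeff_eq_0\<close>)

text \<open>The linear factor acts as the operator \<open>E - c\<close> after \<open>q(E)\<close>,
  so roots can be stripped off one at a time.\<close>

lemma shift_poly_linear_factor:
  "shift_poly ([:-c, 1:] * q) s n = shift_poly q s (Suc n) - c * shift_poly q s n"
proof -
  let ?N = "degree q"
  have "degree ([:-c, 1:] * q) \<le> Suc ?N"
    using degree_mult_le[of "[:-c, 1:]" q] by simp
  then have "shift_poly ([:-c, 1:] * q) s n = (\<Sum>i\<le>Suc ?N. coeff ([:-c, 1:] * q) i * s (n + i))"
    by (rule shift_poly_altdef)
  also have "\<dots> = (\<Sum>i\<le>Suc ?N. coeff (pCons 0 q) i * s (n + i)) - c * (\<Sum>i\<le>Suc ?N. coeff q i * s (n + i))"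
    by (simp only: sum_distrib_left sum_subtractf[symmetric]) (simp add: algebra_simps)
  also have "(\<Sum>i\<le>Suc ?N. coeff (pCons 0 q) i * s (n + i)) = shift_poly q s (Suc n)"
    by (subst sum.atMost_Suc_shift) (simp add: shift_poly_def)
  also have "(\<Sum>i\<le>Suc ?N. coeff q i * s (n + i)) = shift_poly q s n"
    by (rule shift_poly_altdef[symmetric]) simp
  finally show ?thesis .
qed

lemma geometric_bound_step:
  fixes s :: "nat \<Rightarrow> complex"
  assumes c: "norm c < \<rho>" and b: "\<And>n. norm (s (Suc n) - c * s n) \<le> C * \<rho> ^ n"
  shows "\<exists>C. \<forall>n. norm (s n) \<le> C * \<rho> ^ n"
proof -
  have \<rho>: "\<rho> > 0"
    using c norm_ge_zero[of c] by linarith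
  \<comment> \<open>The second term ensures \<open>C + norm c * D \<le> \<rho> * D\<close>, which
    carries the induction; the first covers \<open>n = 0\<close>.\<close>
  define D where "D = max (norm (s 0)) (C / (\<rho> - norm c))"
  have "norm (s n) \<le> D * \<rho> ^ n" for n
  proof (induction n)
    case 0
    show ?case by (simp add: D_def)
  next
    case (Suc n)
    have "C / (\<rho> - norm c) \<le> D"
      by (simp add: D_def)
    then have CD: "C \<le> D * (\<rho> - norm c)"
      using c by (simp add: field_simps)
    have "norm (s (Suc n)) \<le> norm (s (Suc n) - c * s n) + norm (c * s n)"
      using norm_triangle_ineq[of "s (Suc n) - c * s n" "c * s n"] by simp
    also have "\<dots> \<le> C * \<rho> ^ n + norm c * (D * \<rho> ^ n)"
      using b[of n] Suc by (intro add_mono) (auto simp: norm_mult intro: mult_left_mono)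
    also have "\<dots> \<le> D * (\<rho> - norm c) * \<rho> ^ n + norm c * (D * \<rho> ^ n)"
      using CD \<rho> by (intro add_right_mono mult_right_mono) auto
    also have "\<dots> = D * \<rho> ^ Suc n"
      by (simp add: algebra_simps)
    finally show ?case .
  qed
  then show ?thesis by blast
qed

lemma obtain_linear_factor:
  fixes p :: "complex poly"
  assumes "degree p > 0"
  obtains c q where "poly p c = 0" "p = [:-c, 1:] * q" "degree p = Suc (degree q)"
proof -
  obtain c where c: "poly p c = 0"
    using assms fundamental_theorem_of_algebra constant_degree by (metis less_numeral_extra(3))
  then obtain q where q: "p = [:-c, 1:] * q"
    by (auto simp: poly_eq_0_iff_dvd elim: dvdE)
  have "q \<noteq> 0"
    using q assms by auto
  then have "degree p = Suc (degree q)"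
    unfolding q by (subst degree_mult_eq) auto
  with c q show ?thesis using that by blast
qed

text \<open>Induction on the degree, undoing one linear factor at a time by
  \<open>geometric_bound_step\<close>. Multiple roots do no harm, because each root is strictly
  smaller than \<open>\<rho>\<close>.\<close>

lemma shift_poly_geometric_bound:
  fixes p :: "complex poly"
  assumes "p \<noteq> 0" "\<And>z. poly p z = 0 \<Longrightarrow> norm z < \<rho>"
    and "\<exists>C. \<forall>n. norm (shift_poly p s n) \<le> C * \<rho> ^ n"
  shows "\<exists>C. \<forall>n. norm (s n) \<le> C * \<rho> ^ n"
  using assms
proof (induction "degree p" arbitrary: p)
  case 0
  from \<open>0 = degree p\<close> obtain a where p: "p = [:a:]"
    by (metis degree_eq_zeroE)
  then have "a \<noteq> 0"
    using 0 by simp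
  moreover obtain C where C: "\<And>n. norm (shift_poly p s n) \<le> C * \<rho> ^ n"
    using 0 by blast
  ultimately have "norm (s n) \<le> (C / norm a) * \<rho> ^ n" for n
    using C[of n] by (simp add: p shift_poly_def norm_mult field_simps)
  then show ?case by blast
next
  case (Suc m)
  then obtain c q where cq: "poly p c = 0" "p = [:-c, 1:] * q" "degree p = Suc (degree q)"
    using obtain_linear_factor by (metis zero_less_Suc)
  obtain C where "\<And>n. norm (shift_poly p s n) \<le> C * \<rho> ^ n"
    using Suc by blast
  then have "norm (shift_poly q s (Suc n) - c * shift_poly q s n) \<le> C * \<rho> ^ n" for n
    by (simp only: cq(2) shift_poly_linear_factor)
  with Suc.prems(2)[OF cq(1)] have "\<exists>C. \<forall>n. norm (shift_poly q s n) \<le> C * \<rho> ^ n"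
    by (rule geometric_bound_step)
  moreover have "norm z < \<rho>" if "poly q z = 0" for z
    using that Suc.prems(2)[of z] cq(2) by simp
  ultimately show ?case
    using Suc.hyps cq Suc.prems(1) by (metis Suc_inject mult_zero_right)
qed

text \<open>Up to sign, \<open>poly p 0\<close> is the product of the roots. For the characteristic
  polynomial it is the entry of \<open>r\<close> at \<open>first_ix\<close>.\<close>

lemma norm_poly_0_le_1:
  fixes p :: "complex poly"
  assumes "lead_coeff p = 1" "\<And>z. poly p z = 0 \<Longrightarrow> norm z \<le> 1"
  shows "norm (poly p 0) \<le> 1"
  using assms
proof (induction "degree p" arbitrary: p)
  case 0
  then have "poly p 0 = 1" by (simp add: poly_0_coeff_0)
  then show ?case by simp
next
  case (Suc m)
  then obtain c q where cq: "poly p c = 0" "p = [:-c, 1:] * q" "degree p = Suc (degree q)"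
    using obtain_linear_factor by (metis zero_less_Suc)
  have "lead_coeff q = 1"
    using Suc.prems(1) unfolding cq(2) by (subst (asm) lead_coeff_mult) simp
  moreover have "norm z \<le> 1" if "poly q z = 0" for z
    using that Suc.prems(2)[of z] cq(2) by simp
  ultimately have "norm (poly q 0) \<le> 1"
    using Suc.hyps cq(3) by auto
  moreover have "norm c \<le> 1"
    using Suc.prems(2) cq(1) by blast
  ultimately show ?case
    by (simp add: cq(2) norm_mult mult_le_one)
qed

section \<open>Positions in the index type\<close>

definition ix_pos :: "'n::{finite,linorder} \<Rightarrow> nat" where
  "ix_pos i = card {j. j < i}"

lemma first_ix_le: "first_ix \<le> (i :: 'n::{finite,linorder})"
  by (simp add: first_ix_def)

lemma le_last_ix: "(i :: 'n::{finite,linorder}) \<le> last_ix"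
  by (simp add: last_ix_def)

lemma next_ix_least:
  fixes i :: "'n::{finite,linorder}"
  assumes "i \<noteq> last_ix"
  shows "i < next_ix i" and "i < j \<Longrightarrow> next_ix i \<le> j"
proof -
  have "i < last_ix"
    using assms le_last_ix[of i] by simp
  then have "next_ix i \<in> {j. i < j}"
    unfolding next_ix_def by (intro Min_in) auto
  then show "i < next_ix i" by simp
  show "i < j \<Longrightarrow> next_ix i \<le> j"
    unfolding next_ix_def by (intro Min_le) auto
qed

lemma ix_pos_first [simp]: "ix_pos (first_ix :: 'n::{finite,linorder}) = 0"
  using first_ix_le by (auto simp: ix_pos_def not_less)

lemma ix_pos_next:
  fixes i :: "'n::{finite,linorder}"
  assumes "i \<noteq> last_ix"
  shows "ix_pos (next_ix i) = Suc (ix_pos i)"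
proof -
  have "{j. j < next_ix i} = insert i {j. j < i}"
  proof (intro set_eqI iffI)
    fix j assume "j \<in> {j. j < next_ix i}"
    then have "\<not> i < j"
      using next_ix_least(2)[OF assms] leD by blast
    then show "j \<in> insert i {j. j < i}" by auto
  next
    fix j assume "j \<in> insert i {j. j < i}"
    then show "j \<in> {j. j < next_ix i}"
      using next_ix_least(1)[OF assms] less_trans by auto
  qed
  then show ?thesis by (simp add: ix_pos_def)
qed

lemma Suc_ix_pos_last: "Suc (ix_pos (last_ix :: 'n::{finite,linorder})) = CARD('n)"
proof -
  have "insert (last_ix :: 'n) {j. j < last_ix} = UNIV"
    using le_last_ix by (auto simp: less_le)
  moreover have "card (insert (last_ix :: 'n) {j. j < last_ix}) = Suc (card {j. j < (last_ix :: 'n)})"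
    by (rule card_insert_disjoint) auto
  ultimately show ?thesis by (simp add: ix_pos_def)
qed

lemma ix_pos_less: "ix_pos (i :: 'n::{finite,linorder}) < CARD('n)"
proof -
  have "i \<notin> {j. j < i}" by simp
  then have "{j. j < i} \<subset> UNIV" by blast
  then show ?thesis
    unfolding ix_pos_def by (intro psubset_card_mono) simp_all
qed

lemma ix_pos_le_last: "ix_pos (i :: 'n::{finite,linorder}) \<le> ix_pos (last_ix :: 'n)"
  using ix_pos_less[of i] Suc_ix_pos_last[where 'n='n] by simp

lemma ix_pos_less_last:
  assumes "(i :: 'n::{finite,linorder}) \<noteq> last_ix"
  shows "ix_pos i < ix_pos (last_ix :: 'n)"
  using ix_pos_next[OF assms] ix_pos_le_last[of "next_ix i"] by simp

lemma ix_cases: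
  fixes i :: "'n::{finite,linorder}"
  obtains "i = first_ix" | j where "j \<noteq> last_ix" "i = next_ix j"
proof (cases "i = first_ix")
  case False
  define j where "j = Max {k. k < i}"
  have "first_ix < i"
    using False first_ix_le[of i] by (metis order_le_neq_trans)
  then have "j \<in> {k. k < i}"
    unfolding j_def by (intro Max_in) auto
  then have j: "j < i" by simp
  then have jl: "j \<noteq> last_ix"
    using le_last_ix[of i] by (metis leD)
  have "\<not> next_ix j < i"
  proof
    assume "next_ix j < i"
    then have "next_ix j \<le> Max {k. k < i}"
      by (intro Max_ge) auto
    then have "next_ix j \<le> j"
      by (simp only: j_def)
    then show False
      using next_ix_least(1)[OF jl] by simp
  qed
  then have "i = next_ix j"
    using next_ix_least(2)[OF jl j] by simp
  with jl show ?thesis using that(2) by blast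
qed (rule that(1))

lemma ix_induct [case_names first step]:
  fixes i :: "'n::{finite,linorder}"
  assumes "P first_ix" "\<And>i. i \<noteq> last_ix \<Longrightarrow> P i \<Longrightarrow> P (next_ix i)"
  shows "P i"
proof (induction i rule: measure_induct_rule[of ix_pos])
  case (less i)
  show ?case
  proof (cases i rule: ix_cases)
    case (2 j)
    then have "P j" using less ix_pos_next[of j] by simp
    then show ?thesis using assms(2) 2 by blast
  qed (use assms(1) in simp)
qed

text \<open>\<open>v n\<close> is a sliding window of the scalar sequence of first coordinates.
  Orbits of \<open>srs_map\<close> and of the companion matrix both have this form.\<close>

lemma window_eq:
  fixes v :: "nat \<Rightarrow> 'a ^ ('n::{finite,linorder})"
  assumes "\<And>n i. i \<noteq> last_ix \<Longrightarrow> v (Suc n) $ i = v n $ next_ix i"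
  shows "v n $ i = v (n + ix_pos i) $ first_ix"
proof (induction i arbitrary: n rule: ix_induct)
  case (step i)
  have "v n $ next_ix i = v (Suc n) $ i"
    using assms step.hyps by simp
  also have "\<dots> = v (Suc n + ix_pos i) $ first_ix"
    by (rule step.IH)
  finally show ?case using ix_pos_next[OF step.hyps] by simp
qed simp

section \<open>The characteristic polynomial of the companion matrix\<close>

text \<open>The characteristic polynomial of \<open>companion_mat r\<close>, written out by its
  coefficients, and over the complex numbers so that it splits into linear factors.\<close>

definition char_pol :: "real^('n::{finite,linorder}) \<Rightarrow> complex poly" where
  "char_pol r = monom 1 (CARD('n)) + (\<Sum>i\<in>UNIV. monom (of_real (r $ i)) (ix_pos i))"

lemma coeff_char_pol_card:
  "coeff (char_pol (r :: real^('n::{finite,linorder}))) (CARD('n)) = 1"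
proof -
  have "ix_pos i \<noteq> CARD('n)" for i :: 'n
    using ix_pos_less[of i] by simp
  then show ?thesis by (simp add: char_pol_def coeff_sum)
qed

lemma degree_char_pol: "degree (char_pol (r :: real^('n::{finite,linorder}))) = CARD('n)"
proof (rule antisym)
  show "degree (char_pol r) \<le> CARD('n)"
    unfolding char_pol_def
    by (intro degree_add_le degree_sum_le degree_monom_le order.trans[OF degree_monom_le])
       (auto intro: less_imp_le ix_pos_less)
  show "CARD('n) \<le> degree (char_pol r)"
    by (rule le_degree) (simp add: coeff_char_pol_card)
qed

lemma lead_coeff_char_pol: "lead_coeff (char_pol r) = 1"
  by (simp add: degree_char_pol coeff_char_pol_card)

lemma poly_char_pol:
  "poly (char_pol (r :: real^('n::{finite,linorder}))) z
     = z ^ CARD('n) + (\<Sum>i\<in>UNIV. of_real (r $ i) * z ^ ix_pos i)"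
  by (simp add: char_pol_def poly_sum poly_monom)

lemma ix_pos_eq_0_iff: "ix_pos (i :: 'n::{finite,linorder}) = 0 \<longleftrightarrow> i = first_ix"
  by (cases i rule: ix_cases) (auto simp: ix_pos_next dest: arg_cong[where f=ix_pos])

lemma poly_char_pol_0:
  "poly (char_pol (r :: real^('n::{finite,linorder}))) 0 = of_real (r $ first_ix)"
proof -
  have "(\<Sum>i\<in>UNIV. of_real (r $ i) * (0::complex) ^ ix_pos i)
      = (\<Sum>i\<in>UNIV. if i = first_ix then of_real (r $ i) else 0)"
    by (intro sum.cong) (auto simp: ix_pos_eq_0_iff)
  then show ?thesis by (simp add: poly_char_pol)
qed

text \<open>The right-hand side is the defect in a linear recurrence: zero for the first coordinates
  of a companion matrix orbit, a fractional part for those of an \<open>srs_map\<close>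
  orbit.\<close>

lemma shift_poly_char_pol:
  fixes r :: "real^('n::{finite,linorder})"
  shows "shift_poly (char_pol r) s n
     = s (n + CARD('n)) + (\<Sum>i\<in>UNIV. of_real (r $ i) * s (n + ix_pos i))"
proof -
  let ?d = "CARD('n)"
  have mon: "(\<Sum>k\<le>?d. coeff (monom c m) k * s (n + k)) = c * s (n + m)" if "m \<le> ?d" for c m
  proof -
    have "(\<Sum>k\<le>?d. coeff (monom c m) k * s (n + k)) = (\<Sum>k\<le>?d. if k = m then c * s (n + m) else 0)"
      by (intro sum.cong) auto
    then show ?thesis using that by simp
  qed
  have "shift_poly (char_pol r) s n = (\<Sum>k\<le>?d. coeff (monom 1 ?d) k * s (n + k))
      + (\<Sum>k\<le>?d. \<Sum>i\<in>UNIV. coeff (monom (of_real (r $ i)) (ix_pos i)) k * s (n + k))"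
    unfolding shift_poly_def degree_char_pol
    by (simp add: char_pol_def coeff_sum distrib_right sum.distrib sum_distrib_right del: coeff_monom)
  also have "(\<Sum>k\<le>?d. \<Sum>i\<in>UNIV. coeff (monom (of_real (r $ i)) (ix_pos i)) k * s (n + k))
      = (\<Sum>i\<in>UNIV. of_real (r $ i) * s (n + ix_pos i))"
    by (subst sum.swap) (auto intro!: sum.cong mon less_imp_le ix_pos_less simp del: coeff_monom)
  finally show ?thesis by (simp add: mon del: coeff_monom)
qed

section \<open>Roots for parameters with eventually periodic orbits\<close>

lemma eventually_periodic_finite_range:
  assumes "eventually_periodic s"
  shows "finite (range s)"
proof -
  obtain m p where p: "p > 0" "\<And>n. n \<ge> m \<Longrightarrow> s (n + p) = s n"
    using assms by (auto simp: eventually_periodic_def)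
  have "s n \<in> s ` {..<m + p}" for n
  proof (induction n rule: less_induct)
    case (less n)
    show ?case
    proof (cases "n < m + p")
      case False
      then have "s n = s (n - p)"
        using p(2)[of "n - p"] by simp
      then show ?thesis
        using less[of "n - p"] False p(1) by simp
    qed auto
  qed
  then have "range s \<subseteq> s ` {..<m + p}" by blast
  then show ?thesis by (rule finite_subset) simp
qed

lemma shift_poly_bounded:
  assumes "\<And>n. norm (s n) \<le> B"
  shows "norm (shift_poly q s n) \<le> (\<Sum>i\<le>degree q. norm (coeff q i) * B)"
  unfolding shift_poly_def
  by (intro sum_norm_le) (use assms in \<open>auto simp: norm_mult intro!: mult_left_mono\<close>)

lemma srs_map_last: "srs_map r z $ last_ix = - \<lfloor>r \<bullet> real_vec z\<rfloor>"
  by (simp add: srs_map_def)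

lemma srs_map_not_last: "i \<noteq> last_ix \<Longrightarrow> srs_map r z $ i = z $ next_ix i"
  by (simp add: srs_map_def)

lemma expanding_unbounded:
  fixes f :: "nat \<Rightarrow> complex"
  assumes c: "norm c > 1" and step: "\<And>n. norm (f (Suc n) - c * f n) \<le> 1"
    and f0: "norm (f 0) > 1 / (norm c - 1)"
  shows "\<exists>n. norm (f n) > B"
proof -
  \<comment> \<open>The fixed point of the worst case \<open>t \<mapsto> norm c * t - 1\<close> of
    one step; the excess of \<open>norm (f n)\<close> over it grows at least by the factor
    \<open>norm c\<close>.\<close>
  define b where "b = 1 / (norm c - 1)"
  have b: "norm c * b - 1 = b"
    using c by (simp add: b_def field_simps)
  have "b > 0" using c by (simp add: b_def)
  have grow: "norm (f n) - b \<ge> norm c ^ n * (norm (f 0) - b)" for n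
  proof (induction n)
    case (Suc n)
    have "norm (c * f n) \<le> norm (f (Suc n)) + norm (f (Suc n) - c * f n)"
      by (metis norm_triangle_sub norm_minus_commute add.commute)
    then have "norm c * norm (f n) - 1 \<le> norm (f (Suc n))"
      using step[of n] by (simp add: norm_mult)
    moreover have "norm c * (norm c ^ n * (norm (f 0) - b)) \<le> norm c * (norm (f n) - b)"
      using Suc by (intro mult_left_mono) auto
    ultimately show ?case using b by (simp add: algebra_simps)
  qed simp
  obtain n where "norm c ^ n > B / (norm (f 0) - b)"
    using real_arch_pow[OF c] by blast
  then have "norm c ^ n * (norm (f 0) - b) > B"
    using f0 by (simp add: b_def[symmetric] field_simps)
  then show ?thesis using grow[of n] \<open>b > 0\<close> by (intro exI[of _ n]) linarith
qed

text \<open>Writing \<open>char_pol r = (X - c) q\<close>, the quantity \<open>shift_poly q a\<close> of an orbit \<open>a\<close> is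
  multiplied by \<open>c\<close> in each step up to an error in \<open>[0, 1)\<close>. Hence it escapes to infinity when
  \<open>norm c > 1\<close> and the starting point is a large multiple of the last unit vector.\<close>
lemma srs_D_imp_roots_le_1:
  fixes r :: "real^('n::{finite,linorder})"
  assumes r: "r \<in> srs_D" and root: "poly (char_pol r) c = 0"
  shows "norm c \<le> 1"
proof (rule ccontr)
  assume "\<not> norm c \<le> 1"
  then have c: "norm c > 1" by simp
  obtain q where q: "char_pol r = [:-c, 1:] * q"
    using root by (auto simp: poly_eq_0_iff_dvd elim: dvdE)
  have "q \<noteq> 0"
    using q lead_coeff_char_pol[of r] by auto
  then have deg: "Suc (degree q) = CARD('n)"
    using degree_char_pol[of r] unfolding q by (subst (asm) degree_mult_eq) auto
  have lead: "lead_coeff q = 1"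
    using lead_coeff_char_pol[of r] unfolding q by (subst (asm) lead_coeff_mult) simp
  \<comment> \<open>The threshold of \<open>expanding_unbounded\<close>; \<open>K\<close> will be
    the initial value of \<open>shift_poly q a\<close>.\<close>
  obtain K :: nat where K: "real K > 1 / (norm c - 1)"
    using reals_Archimedean2 by blast
  define z :: "int^('n::{finite,linorder})" where "z = (\<chi> i. if i = last_ix then int K else 0)"
  define v where "v n = (srs_map r ^^ n) z" for n
  define a :: "nat \<Rightarrow> complex" where "a n = of_int (v n $ first_ix)" for n
  have v_Suc: "v (Suc n) = srs_map r (v n)" for n
    by (simp add: v_def)
  have win: "v n $ i = v (n + ix_pos i) $ first_ix" for n i
    by (rule window_eq) (simp add: v_Suc srs_map_not_last)
  have a: "a (n + ix_pos i) = of_int (v n $ i)" for n i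
    by (simp add: a_def win[of n i])
  \<comment> \<open>Position \<open>CARD('n)\<close> is just beyond the window at \<open>n\<close>
    and is the last entry of the window at \<open>Suc n\<close>.\<close>
  have dlast: "a (n + CARD('n)) = of_int (v (Suc n) $ last_ix)" for n
    using a[of "Suc n" last_ix] Suc_ix_pos_last[where 'n='n] by (metis add_Suc_right add_Suc)
  have dist: "norm (shift_poly (char_pol r) a n) \<le> 1" for n
  proof -
    have "shift_poly (char_pol r) a n = of_real (frac (r \<bullet> real_vec (v n)))"
      unfolding shift_poly_char_pol dlast a v_Suc srs_map_last
      by (simp add: frac_def inner_vec_def real_vec_def)
    then show ?thesis
      using frac_lt_1[of "r \<bullet> real_vec (v n)"] by simp
  qed
  have step: "norm (shift_poly q a (Suc n) - c * shift_poly q a n) \<le> 1" for n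
    using dist[of n] by (simp only: q shift_poly_linear_factor)
  \<comment> \<open>Eventual periodicity makes the orbit finite, so \<open>a\<close>, and with it
    \<open>shift_poly q a\<close>, is bounded.\<close>
  have "finite (range v)"
    using r eventually_periodic_finite_range unfolding srs_D_def v_def by blast
  then have "finite ((\<lambda>u. of_int (u $ first_ix) :: complex) ` range v)"
    by (rule finite_imageI)
  then have "finite (range a)"
    by (simp add: a_def[abs_def] image_image)
  then obtain B where B: "\<And>n. norm (a n) \<le> B"
    using finite_imp_bounded[of "range a"] by (auto simp: bounded_iff)
  \<comment> \<open>\<open>degree q\<close> is the position of \<open>last_ix\<close>, where
    \<open>z\<close> has its only nonzero entry, and \<open>q\<close> is monic.\<close>
  have "shift_poly q a 0 = of_nat K"
  proof -
    have a0: "coeff q k * a k = (if k = degree q then of_nat K else 0)" if "k \<le> degree q" for k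
    proof -
      have "k < CARD('n)" using that deg by simp
      then obtain i :: 'n where i: "ix_pos i = k"
      proof (induction k arbitrary: thesis)
        case 0
        then show ?case using ix_pos_first by blast
      next
        case (Suc k)
        then obtain i :: 'n where i: "ix_pos i = k" by auto
        with Suc.prems have "i \<noteq> last_ix"
          using Suc_ix_pos_last[where 'n='n] by auto
        then show ?case using Suc.prems(1) ix_pos_next i by blast
      qed
      have "a k = of_int (z $ i)"
        using a[of 0 i] i by (simp add: v_def)
      moreover have "k = degree q \<longleftrightarrow> i = last_ix"
        using ix_pos_less_last[of i] Suc_ix_pos_last[where 'n='n] deg i by (cases "i = last_ix") auto
      ultimately show ?thesis using lead by (auto simp: z_def)
    qed
    then have "shift_poly q a 0 = (\<Sum>k\<le>degree q. if k = degree q then of_nat K else 0)"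
      unfolding shift_poly_def by (intro sum.cong) auto
    then show ?thesis by simp
  qed
  then have "\<exists>n. norm (shift_poly q a n) > (\<Sum>i\<le>degree q. norm (coeff q i) * B)"
    using c step K by (intro expanding_unbounded[of c]) auto
  then show False
    using shift_poly_bounded[of a B q] B by (meson not_le)
qed

text \<open>Multiplying all roots by a factor slightly larger than 1 perturbs the parameter only slightly.\<close>
lemma interior_srs_D_imp_roots_less_1:
  fixes r :: "real^('n::{finite,linorder})"
  assumes "r \<in> interior srs_D"
  obtains \<rho> where "0 < \<rho>" "\<rho> < 1" "\<And>z. poly (char_pol r) z = 0 \<Longrightarrow> norm z < \<rho>"
proof -
  \<comment> \<open>The roots of \<open>char_pol (f t)\<close> are those of
    \<open>char_pol r\<close> multiplied by \<open>t\<close>.\<close>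
  define f :: "real \<Rightarrow> real^('n::{finite,linorder})" where "f t = (\<chi> i. r $ i * t ^ (CARD('n) - ix_pos i))" for t
  have "continuous_on UNIV f"
    unfolding f_def by (intro continuous_intros)
  then have "open (f -` interior srs_D)"
    by (simp add: open_vimage)
  moreover have "f 1 = r"
    by (simp add: f_def vec_eq_iff)
  ultimately obtain e where e: "e > 0" "ball 1 e \<subseteq> f -` interior srs_D"
    using assms by (metis open_contains_ball vimageI)
  define t where "t = 1 + e / 2"
  have t: "t > 1" using e by (simp add: t_def)
  have "t \<in> ball 1 e" using e by (simp add: t_def dist_real_def)
  then have ft: "f t \<in> srs_D"
    using e interior_subset by blast
  have "norm z \<le> 1 / t" if "poly (char_pol r) z = 0" for z
  proof -
    have "of_real (f t $ i) * (of_real t * z) ^ ix_pos i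
        = of_real t ^ CARD('n) * (of_real (r $ i) * z ^ ix_pos i)" for i
    proof -
      have "t ^ CARD('n) = t ^ (CARD('n) - ix_pos i) * t ^ ix_pos i"
        using ix_pos_less[of i] by (simp flip: power_add)
      then show ?thesis
        by (simp add: f_def power_mult_distrib flip: of_real_power)
    qed
    then have "poly (char_pol (f t)) (of_real t * z) = of_real t ^ CARD('n) * poly (char_pol r) z"
      unfolding poly_char_pol by (simp only: power_mult_distrib[of "of_real t" z "CARD('n)"] distrib_left sum_distrib_left)
    then have "norm (of_real t * z) \<le> 1"
      using that ft by (intro srs_D_imp_roots_le_1) auto
    then show ?thesis using t by (simp add: norm_mult field_simps)
  qed
  \<comment> \<open>The root bound \<open>1 / t\<close> is not strict, so \<open>\<rho>\<close> is
    taken to be the midpoint of \<open>1 / t\<close> and 1.\<close>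
  moreover have "1 / t < (1 / t + 1) / 2" "(1 / t + 1) / 2 < 1" "0 < (1 / t + 1) / 2"
    using t by (auto simp: field_simps)
  ultimately show ?thesis
    by (intro that[of "(1 / t + 1) / 2"]) fastforce+
qed

section \<open>Contraction of the companion matrix\<close>

lemma mat_power_mult_vec:
  fixes M :: "real^'n^'n"
  shows "mat_power M n *v v = (((*v) M) ^^ n) v"
  by (induction n) (simp_all add: mat_power_def matrix_vector_mul_assoc[symmetric])

lemma mat_power_Suc_mult_vec:
  fixes M :: "real^'n^'n"
  shows "mat_power M (Suc n) *v v = mat_power M n *v (M *v v)"
  by (simp add: mat_power_mult_vec funpow_swap1)

lemma companion_mult_last: "(companion_mat r *v v) $ last_ix = - (r \<bullet> v)"
  by (simp add: companion_mat_def matrix_vector_mult_def inner_vec_def sum_negf)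

lemma companion_mult_not_last:
  assumes "i \<noteq> last_ix"
  shows "(companion_mat r *v v) $ i = v $ next_ix i"
proof -
  have "(companion_mat r *v v) $ i = (\<Sum>j\<in>UNIV. (if j = next_ix i then 1 else 0) * v $ j)"
    using assms by (simp add: companion_mat_def matrix_vector_mult_def)
  also have "\<dots> = (\<Sum>j\<in>UNIV. if j = next_ix i then v $ j else 0)"
    by (intro sum.cong) auto
  finally show ?thesis by simp
qed

text \<open>The first coordinates of the orbit solve the homogeneous recurrence with polynomial
  \<open>char_pol r\<close>, so \<open>shift_poly_geometric_bound\<close> applies to them.\<close>

lemma companion_orbit_bound:
  fixes r :: "real^('n::{finite,linorder})"
  assumes \<rho>: "0 < \<rho>" "\<And>z. poly (char_pol r) z = 0 \<Longrightarrow> norm z < \<rho>"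
  shows "\<exists>C. \<forall>n. norm (mat_power (companion_mat r) n *v u) \<le> C * \<rho> ^ n"
proof -
  define v where "v n = mat_power (companion_mat r) n *v u" for n
  define a :: "nat \<Rightarrow> complex" where "a n = of_real (v n $ first_ix)" for n
  have v_Suc: "v (Suc n) = companion_mat r *v v n" for n
    by (simp add: v_def mat_power_mult_vec)
  have win: "v n $ i = v (n + ix_pos i) $ first_ix" for n i
    by (rule window_eq) (simp add: v_Suc companion_mult_not_last)
  have a: "a (n + ix_pos i) = of_real (v n $ i)" for n i
    by (simp add: a_def win[of n i])
  have dlast: "a (n + CARD('n)) = of_real (v (Suc n) $ last_ix)" for n
    using a[of "Suc n" last_ix] Suc_ix_pos_last[where 'n='n] by (metis add_Suc_right add_Suc)
  have "shift_poly (char_pol r) a n = 0" for n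
    unfolding shift_poly_char_pol dlast a v_Suc companion_mult_last
    by (simp add: inner_vec_def)
  then have "\<exists>C. \<forall>n. norm (shift_poly (char_pol r) a n) \<le> C * \<rho> ^ n"
    by (intro exI[of _ 0]) simp
  moreover have "char_pol r \<noteq> 0"
    using lead_coeff_char_pol[of r] by auto
  ultimately obtain C where C: "\<And>n. norm (a n) \<le> C * \<rho> ^ n"
    using shift_poly_geometric_bound[of "char_pol r" \<rho> a] \<rho>(2) by blast
  \<comment> \<open>Coordinate \<open>i\<close> at time \<open>n\<close> is the first coordinate at
    time \<open>n + ix_pos i\<close>, whence the factor \<open>\<rho> ^ ix_pos i\<close>.\<close>
  have "norm (v n) \<le> (\<Sum>i::'n\<in>UNIV. C * \<rho> ^ ix_pos i) * \<rho> ^ n" for n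
  proof -
    have "norm (v n) \<le> (\<Sum>i\<in>UNIV. \<bar>v n $ i\<bar>)"
      by (rule norm_le_l1_cart)
    also have "\<dots> \<le> (\<Sum>i::'n\<in>UNIV. C * \<rho> ^ ix_pos i * \<rho> ^ n)"
    proof (rule sum_mono)
      fix i :: 'n
      show "\<bar>v n $ i\<bar> \<le> C * \<rho> ^ ix_pos i * \<rho> ^ n"
        using C[of "n + ix_pos i"] by (simp add: a power_add mult_ac)
    qed
    finally show ?thesis by (simp add: sum_distrib_right)
  qed
  then show ?thesis unfolding v_def by blast
qed

section \<open>Preimages\<close>

text \<open>Both maps shift the coordinates; they differ only in the last one, where
  \<open>srs_map\<close> rounds the inner product down before negating it.\<close>

lemma companion_mult_preimage:
  "companion_mat r *v real_vec z = real_vec (srs_map r z) - frac (r \<bullet> real_vec z) *\<^sub>R axis last_ix 1"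
proof -
  have "(companion_mat r *v real_vec z) $ i
      = (real_vec (srs_map r z) - frac (r \<bullet> real_vec z) *\<^sub>R axis last_ix 1) $ i" for i
    by (cases "i = last_ix")
       (simp_all add: companion_mult_last companion_mult_not_last real_vec_def srs_map_last
         srs_map_not_last frac_def axis_def)
  then show ?thesis by (simp add: vec_eq_iff)
qed

lemma srs_preimage_0: "srs_preimage r 0 x = {x}"
  by (simp add: srs_preimage_def)

text \<open>Extends a backward path at its far end, which relates consecutive approximations of one
  tile.\<close>

lemma srs_preimage_Suc: "srs_preimage r (Suc n) x = (\<Union>y\<in>srs_preimage r n x. srs_preimage r 1 y)"
  by (auto simp: srs_preimage_def funpow_swap1)

text \<open>Splits a backward path at the step next to \<open>x\<close>, as the set equation
  does.\<close>

lemma srs_preimage_Suc': "srs_preimage r (Suc n) x = (\<Union>y\<in>srs_preimage r 1 x. srs_preimage r n y)"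
  by (auto simp: srs_preimage_def)

lemma srs_preimage_1_iff:
  "z \<in> srs_preimage r 1 x \<longleftrightarrow>
     (\<forall>i. i \<noteq> last_ix \<longrightarrow> z $ next_ix i = x $ i) \<and> \<lfloor>r \<bullet> real_vec z\<rfloor> = - (x $ last_ix)"
  by (auto simp: srs_preimage_def srs_map_def vec_eq_iff)

lemma inner_split_first:
  fixes r v :: "real^('n::{finite,linorder})"
  shows "r \<bullet> v = r $ first_ix * v $ first_ix + (\<Sum>i\<in>UNIV - {first_ix}. r $ i * v $ i)"
  by (simp add: inner_vec_def sum.remove[of UNIV first_ix])

text \<open>Multiples of \<open>c\<close> are spaced at most 1 apart, so none of these half-open
  intervals is skipped. Rounding \<open>a / c\<close> up, or down for negative \<open>c\<close>,
  gives the first multiple at or above \<open>a\<close>.\<close>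

lemma ex_int_multiple_in_unit_interval:
  fixes c a :: real
  assumes "c \<noteq> 0" "\<bar>c\<bar> \<le> 1"
  shows "\<exists>k::int. a \<le> c * of_int k \<and> c * of_int k < a + 1"
proof (cases "c > 0")
  case True
  have "a / c \<le> of_int \<lceil>a / c\<rceil> \<and> of_int \<lceil>a / c\<rceil> < a / c + 1"
    by linarith
  then obtain k :: int where k: "a / c \<le> of_int k" "of_int k < a / c + 1"
    by blast
  then have "a \<le> c * of_int k" "c * of_int k < a + c"
    using True by (simp_all add: field_simps)
  then show ?thesis using assms True by (intro exI[of _ k]) auto
next
  case False
  then have c: "c < 0" using assms by simp
  have "of_int \<lfloor>a / c\<rfloor> \<le> a / c \<and> a / c < of_int \<lfloor>a / c\<rfloor> + 1"
    by linarith
  then obtain k :: int where k: "of_int k \<le> a / c" "a / c < of_int k + 1"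
    by blast
  then have "a \<le> c * of_int k" "c * of_int k < a - c"
    using c by (simp_all add: field_simps)
  then show ?thesis using assms c by (intro exI[of _ k]) auto
qed

text \<open>Only the first coordinate of a preimage is free, and the floor condition asks its
  multiple by \<open>r $ first_ix\<close> to lie in a half-open interval of length 1.\<close>

lemma srs_preimage_1_nonempty:
  fixes r :: "real^('n::{finite,linorder})"
  assumes "r $ first_ix \<noteq> 0" "\<bar>r $ first_ix\<bar> \<le> 1"
  shows "srs_preimage r 1 x \<noteq> {}"
proof -
  \<comment> \<open>The inverse of \<open>next_ix\<close>; its value at \<open>first_ix\<close> is
    arbitrary, and \<open>w\<close> puts \<open>k\<close> there instead.\<close>
  define prev :: "'n \<Rightarrow> 'n" where "prev j = (SOME i. i \<noteq> last_ix \<and> next_ix i = j)" for j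
  have next_inj: "i = i'" if "i \<noteq> last_ix" "i' \<noteq> last_ix" "next_ix i = next_ix i'" for i i' :: 'n
    using next_ix_least[OF that(1)] next_ix_least[OF that(2)] that(3)
    by (metis linorder_neqE not_less)
  have prev: "prev (next_ix i) = i" if "i \<noteq> last_ix" for i :: 'n
    unfolding prev_def by (rule some_equality) (use that next_inj in auto)
  define w :: "int \<Rightarrow> int^('n::{finite,linorder})" where "w k = (\<chi> j. if j = first_ix then k else x $ prev j)" for k
  \<comment> \<open>Chosen so that the floor condition on \<open>w k\<close> becomes
    \<open>a \<le> r $ first_ix * k < a + 1\<close>.\<close>
  define a where "a = - of_int (x $ last_ix) - (\<Sum>i\<in>UNIV - {first_ix}. r $ i * of_int (x $ prev i))"
  obtain k where k: "a \<le> r $ first_ix * of_int k" "r $ first_ix * of_int k < a + 1"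
    using ex_int_multiple_in_unit_interval assms by blast
  have "r \<bullet> real_vec (w k) = r $ first_ix * of_int k + (\<Sum>i\<in>UNIV - {first_ix}. r $ i * of_int (x $ prev i))"
    unfolding inner_split_first by (auto simp: real_vec_def w_def intro!: sum.cong)
  then have "\<lfloor>r \<bullet> real_vec (w k)\<rfloor> = - (x $ last_ix)"
    using k unfolding a_def by (intro floor_unique) auto
  moreover have "w k $ next_ix i = x $ i" if "i \<noteq> last_ix" for i
  proof -
    have "next_ix i \<noteq> first_ix"
      using next_ix_least(1)[OF that] first_ix_le[of i] by auto
    then show ?thesis by (simp add: w_def prev[OF that])
  qed
  ultimately have "w k \<in> srs_preimage r 1 x"
    by (simp add: srs_preimage_1_iff del: One_nat_def)
  then show ?thesis by blast
qed

text \<open>Two preimages differ only in the first coordinate, and equal floors bound that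
  difference by \<open>1 / \<bar>r $ first_ix\<bar>\<close>.\<close>

lemma finite_srs_preimage_1:
  fixes r :: "real^('n::{finite,linorder})"
  assumes r0: "r $ first_ix \<noteq> 0"
  shows "finite (srs_preimage r 1 x)"
proof (cases "srs_preimage r 1 x = {}")
  case False
  then obtain y where y: "y \<in> srs_preimage r 1 x" by blast
  define b where "b = 1 / \<bar>r $ first_ix\<bar>"
  have agree: "z $ i = y $ i" if "z \<in> srs_preimage r 1 x" "i \<noteq> first_ix" for z i
    using that y by (cases i rule: ix_cases) (auto simp: srs_preimage_1_iff simp del: One_nat_def)
  have "inj_on (\<lambda>z. z $ first_ix) (srs_preimage r 1 x)"
    using agree by (intro inj_onI) (metis vec_eq_iff)
  moreover have "(\<lambda>z. z $ first_ix) ` srs_preimage r 1 x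
      \<subseteq> {\<lfloor>real_of_int (y $ first_ix) - b\<rfloor>..\<lceil>real_of_int (y $ first_ix) + b\<rceil>}"
  proof (rule image_subsetI)
    fix z assume z: "z \<in> srs_preimage r 1 x"
    have "(\<Sum>i\<in>UNIV - {first_ix}. r $ i * real_vec z $ i) = (\<Sum>i\<in>UNIV - {first_ix}. r $ i * real_vec y $ i)"
      using agree[OF z] by (intro sum.cong) (auto simp: real_vec_def)
    then have "r \<bullet> real_vec z - r \<bullet> real_vec y = r $ first_ix * (of_int (z $ first_ix) - of_int (y $ first_ix))"
      unfolding inner_split_first by (simp add: real_vec_def algebra_simps)
    moreover have "\<lfloor>r \<bullet> real_vec z\<rfloor> = \<lfloor>r \<bullet> real_vec y\<rfloor>"
      using y z by (simp add: srs_preimage_1_iff del: One_nat_def)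
    then have "\<bar>r \<bullet> real_vec z - r \<bullet> real_vec y\<bar> \<le> 1" by linarith
    ultimately have "\<bar>r $ first_ix\<bar> * \<bar>of_int (z $ first_ix) - real_of_int (y $ first_ix)\<bar> \<le> 1"
      by (simp add: abs_mult)
    then have "\<bar>of_int (z $ first_ix) - real_of_int (y $ first_ix)\<bar> \<le> b"
      using r0 by (simp add: b_def field_simps)
    then show "z $ first_ix \<in> {\<lfloor>real_of_int (y $ first_ix) - b\<rfloor>..\<lceil>real_of_int (y $ first_ix) + b\<rceil>}"
      by (auto simp: floor_le_iff le_ceiling_iff)
  qed
  ultimately show ?thesis
    by (metis finite_atLeastAtMost_int finite_imageD finite_subset)
qed simp

lemma finite_srs_preimage:
  fixes r :: "real^('n::{finite,linorder})"
  assumes "r $ first_ix \<noteq> 0"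
  shows "finite (srs_preimage r n x)"
  by (induction n) (auto simp: srs_preimage_0 srs_preimage_Suc finite_srs_preimage_1[OF assms] simp del: One_nat_def)

lemma srs_preimage_nonempty:
  fixes r :: "real^('n::{finite,linorder})"
  assumes "r $ first_ix \<noteq> 0" "\<bar>r $ first_ix\<bar> \<le> 1"
  shows "srs_preimage r n x \<noteq> {}"
proof (induction n)
  case (Suc n)
  then show ?case
    using srs_preimage_1_nonempty[OF assms] unfolding srs_preimage_Suc by fastforce
qed (simp add: srs_preimage_0)

text \<open>The set equation at a finite stage, with the index dropping by one on the right.\<close>

lemma srs_approx_Suc:
  "srs_approx r x (Suc n) = (\<Union>y\<in>srs_preimage r 1 x. (\<lambda>t. companion_mat r *v t) ` srs_approx r y n)"
  unfolding srs_approx_def srs_preimage_Suc' by (auto simp: mat_power_mult_vec image_iff)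

section \<open>Hausdorff limits of geometrically converging set sequences\<close>

lemma closed_lower_hausdorff_lim: "closed (lower_hausdorff_lim A)"
proof -
  have "t \<in> lower_hausdorff_lim A" if "t \<in> closure (lower_hausdorff_lim A)" for t
  proof -
    have "\<forall>\<^sub>F n in sequentially. U \<inter> A n \<noteq> {}" if U: "open U" "t \<in> U" for U
    proof -
      obtain s where "s \<in> U" "s \<in> lower_hausdorff_lim A"
        using \<open>t \<in> closure _\<close> U by (auto simp: closure_iff_nhds_not_empty)
      then show ?thesis using U by (auto simp: lower_hausdorff_lim_def)
    qed
    then show ?thesis by (auto simp: lower_hausdorff_lim_def)
  qed
  then show ?thesis
    using closure_subset_eq by blast
qed

lemma tendsto_imp_lower_hausdorff_lim:
  assumes "s \<longlonglongrightarrow> t" "\<forall>\<^sub>F n in sequentially. s n \<in> A n"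
  shows "t \<in> lower_hausdorff_lim A"
proof -
  have "\<forall>\<^sub>F n in sequentially. U \<inter> A n \<noteq> {}" if "open U" "t \<in> U" for U
    using topological_tendstoD[OF assms(1) that] assms(2) by eventually_elim auto
  then show ?thesis by (auto simp: lower_hausdorff_lim_def)
qed

lemma lower_hausdorff_lim_Suc: "lower_hausdorff_lim (\<lambda>n. A (Suc n)) = lower_hausdorff_lim A"
  unfolding lower_hausdorff_lim_def
  by (rule Collect_cong)
     (metis (mono_tags, lifting) eventually_sequentially_Suc[where P="\<lambda>n. _ \<inter> A n \<noteq> {}"])

text \<open>Consecutive sets have Hausdorff distance at most \<open>C * \<rho> ^ n\<close>. Stating
  this by nearby points, in both directions, allows chains of points to be built directly.\<close>

locale geometric_sets =
  fixes A :: "nat \<Rightarrow> 'a::{heine_borel,complete_space} set" and C \<rho> :: real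
  assumes C: "0 \<le> C" and \<rho>: "0 < \<rho>" "\<rho> < 1"
    and cpt: "\<And>n. compact (A n)" and nonempty: "\<And>n. A n \<noteq> {}"
    and up: "\<And>n a. a \<in> A n \<Longrightarrow> \<exists>b\<in>A (Suc n). dist a b \<le> C * \<rho> ^ n"
    and down: "\<And>n b. b \<in> A (Suc n) \<Longrightarrow> \<exists>a\<in>A n. dist a b \<le> C * \<rho> ^ n"
begin

text \<open>The remainder of the geometric series with terms \<open>C * \<rho>^k\<close>, starting at \<open>k = n\<close>.\<close>
definition tail :: "nat \<Rightarrow> real" where
  "tail n = C * \<rho> ^ n / (1 - \<rho>)"

lemma tail_Suc: "tail n = C * \<rho> ^ n + tail (Suc n)"
  using \<rho> by (simp add: tail_def field_simps)

lemma tail_nonneg: "tail n \<ge> 0"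
  using \<rho> C by (simp add: tail_def)

lemma tail_tendsto: "tail \<longlonglongrightarrow> 0"
proof -
  have "(\<lambda>n. C / (1 - \<rho>) * \<rho> ^ n) \<longlonglongrightarrow> C / (1 - \<rho>) * 0"
    using \<rho> by (intro tendsto_mult tendsto_const LIMSEQ_power_zero) simp
  then show ?thesis by (simp add: tail_def[abs_def])
qed

text \<open>Repeated use of \<open>up\<close> gives a chain starting at \<open>a\<close> with
  summable step lengths; it is Cauchy, and its limit is the required point.\<close>

lemma ex_limit_near:
  assumes "a \<in> A n"
  shows "\<exists>t\<in>lower_hausdorff_lim A. dist a t \<le> tail n"
proof -
  have "\<exists>s. \<forall>k. (s k \<in> A (n + k) \<and> (k = 0 \<longrightarrow> s k = a)) \<and> dist (s k) (s (Suc k)) \<le> C * \<rho> ^ (n + k)"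
    using assms up by (intro dependent_nat_choice) auto
  then obtain s where s: "\<And>k. s k \<in> A (n + k)" "s 0 = a"
      "\<And>k. dist (s k) (s (Suc k)) \<le> C * \<rho> ^ (n + k)"
    by blast
  have chain: "dist (s k) (s (k + m)) \<le> tail (n + k) - tail (n + k + m)" for k m
  proof (induction m)
    case (Suc m)
    then show ?case
      using s(3)[of "k + m"] dist_triangle[of "s k" "s (Suc (k + m))" "s (k + m)"]
        tail_Suc[of "n + k + m"] by (simp add: add.assoc)
  qed simp
  have near: "dist (s k) (s m) \<le> tail (n + k)" if "k \<le> m" for k m
    using chain[of k "m - k"] tail_nonneg[of "n + m"] that by simp
  have "Cauchy s"
  proof (rule metric_CauchyI)
    fix e :: real assume "e > 0"
    then have "\<forall>\<^sub>F k in sequentially. tail k < e / 2"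
      by (intro order_tendstoD(2)[OF tail_tendsto]) simp
    then obtain N where N: "\<And>k. k \<ge> N \<Longrightarrow> tail k < e / 2"
      by (auto simp: eventually_sequentially)
    have "dist (s k) (s m) < e" if "k \<ge> N" "m \<ge> N" for k m
      using near[OF that(1)] near[OF that(2)] N[of "n + N"] dist_triangle_half_r[of "s N" "s k" e "s m"]
      by fastforce
    then show "\<exists>M. \<forall>m\<ge>M. \<forall>n\<ge>M. dist (s m) (s n) < e" by blast
  qed
  then obtain t where t: "s \<longlonglongrightarrow> t"
    using Cauchy_convergent convergent_def by blast
  have "dist a t \<le> tail n"
    using tendsto_dist[OF tendsto_const t, of a] near[of 0] s(2)
    by (intro LIMSEQ_le_const2[where X="\<lambda>k. dist a (s k)"]) auto
  moreover have "t \<in> lower_hausdorff_lim A"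
  proof (rule tendsto_imp_lower_hausdorff_lim)
    \<comment> \<open>Reindexing puts the \<open>k\<close>-th point into \<open>A k\<close>;
      truncated subtraction affects only the finitely many \<open>k < n\<close>.\<close>
    show "(\<lambda>k. s (k - n)) \<longlonglongrightarrow> t"
      by (rule LIMSEQ_offset[where k=n]) (simp add: t)
    show "\<forall>\<^sub>F k in sequentially. s (k - n) \<in> A k"
      using s(1) by (intro eventually_sequentiallyI[of n]) (metis le_add_diff_inverse)
  qed
  ultimately show ?thesis by blast
qed

text \<open>Walks back by \<open>down\<close>; subtracting \<open>tail (n + m)\<close> makes the
  estimate telescope exactly.\<close>

lemma ex_earlier_near:
  assumes "b \<in> A (n + m)"
  shows "\<exists>a\<in>A n. dist a b \<le> tail n - tail (n + m)"
  using assms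
proof (induction m arbitrary: b)
  case (Suc m)
  then obtain c where c: "c \<in> A (n + m)" "dist c b \<le> C * \<rho> ^ (n + m)"
    using down[of b "n + m"] by auto
  with Suc obtain a where "a \<in> A n" "dist a c \<le> tail n - tail (n + m)" by blast
  with c show ?case
    using tail_Suc[of "n + m"] dist_triangle[of a b c] by (intro bexI[of _ a]) auto
qed auto

text \<open>Points of arbitrarily late sets come close to \<open>t\<close>, and walking back from
  them to \<open>A n\<close> costs at most \<open>tail n\<close>.\<close>

lemma infdist_limit_le:
  assumes "t \<in> lower_hausdorff_lim A"
  shows "infdist t (A n) \<le> tail n"
proof (rule field_le_epsilon)
  fix e :: real assume "e > 0"
  then have "\<forall>\<^sub>F k in sequentially. ball t e \<inter> A k \<noteq> {}"
    using assms by (auto simp: lower_hausdorff_lim_def)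
  then obtain N where "\<And>k. k \<ge> N \<Longrightarrow> ball t e \<inter> A k \<noteq> {}"
    by (auto simp: eventually_sequentially)
  from this[of "n + N"] obtain b where b: "b \<in> A (n + N)" "dist t b < e"
    by auto
  then obtain a where a: "a \<in> A n" "dist a b \<le> tail n - tail (n + N)"
    using ex_earlier_near by blast
  have "infdist t (A n) \<le> dist t a"
    by (rule infdist_le[OF a(1)])
  also have "\<dots> \<le> dist t b + dist a b"
    by (metis dist_commute dist_triangle)
  finally show "infdist t (A n) \<le> tail n + e"
    using b a tail_nonneg[of "n + N"] by simp
qed

lemma limit_nonempty: "lower_hausdorff_lim A \<noteq> {}"
  using nonempty[of 0] ex_limit_near by blast

lemma compact_limit: "compact (lower_hausdorff_lim A)"
proof -
  have "bounded (lower_hausdorff_lim A)"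
  proof -
    obtain c e where ce: "\<And>a. a \<in> A 0 \<Longrightarrow> dist c a \<le> e"
      using compact_imp_bounded[OF cpt[of 0]] unfolding bounded_def by blast
    have "dist c t \<le> e + tail 0" if "t \<in> lower_hausdorff_lim A" for t
    proof -
      obtain a where a: "a \<in> A 0" "infdist t (A 0) = dist t a"
        using infdist_attains_inf compact_imp_closed[OF cpt] nonempty by metis
      then show ?thesis
        using infdist_limit_le[OF that, of 0] ce[OF a(1)] dist_triangle[of c t a]
        by (simp add: dist_commute)
    qed
    then show ?thesis unfolding bounded_def by blast
  qed
  then show ?thesis
    by (simp add: compact_eq_bounded_closed closed_lower_hausdorff_lim)
qed

lemma has_hausdorff_lim_limit: "has_hausdorff_lim A (lower_hausdorff_lim A)"
proof -
  let ?T = "lower_hausdorff_lim A"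
  have near: "infdist a ?T \<le> tail n" if "a \<in> A n" for a n
    using ex_limit_near[OF that] infdist_le order.trans by blast
  have upper: "hausdorff_dist (A n) ?T \<le> tail n" for n
    unfolding hausdorff_dist_def
    using nonempty limit_nonempty near infdist_limit_le by (auto intro!: cSUP_least)
  \<comment> \<open>A supremum of reals is only meaningful for a set bounded above, so boundedness
    is shown before comparing with it.\<close>
  have lower: "0 \<le> hausdorff_dist (A n) ?T" for n
  proof -
    obtain a where a: "a \<in> A n" using nonempty by blast
    have "bdd_above ((\<lambda>a. infdist a ?T) ` A n)"
      using near by (intro bdd_aboveI2)
    then have "infdist a ?T \<le> (SUP a\<in>A n. infdist a ?T)"
      using a by (rule cSUP_upper[rotated])
    then show ?thesis
      using infdist_nonneg[of a ?T] by (simp add: hausdorff_dist_def le_max_iff_disj)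
  qed
  have "(\<lambda>n. hausdorff_dist (A n) ?T) \<longlonglongrightarrow> 0"
    by (rule tendsto_sandwich[OF _ _ tendsto_const tail_tendsto]) (auto simp: upper lower)
  then show ?thesis
    using nonempty cpt limit_nonempty compact_limit by (simp add: has_hausdorff_lim_def)
qed

end

section \<open>The set equation\<close>

text \<open>The first bound makes preimages exist. For the second, the last unit vector suffices,
  since the error in \<open>companion_mult_preimage\<close> is a multiple of it.\<close>

lemma interior_srs_D_contraction:
  fixes r :: "real^('n::{finite,linorder})"
  assumes "r \<in> interior srs_D"
  shows "\<bar>r $ first_ix\<bar> \<le> 1"
    and "\<exists>C\<ge>0. \<exists>\<rho>. 0 < \<rho> \<and> \<rho> < 1 \<and>
      (\<forall>n. norm (mat_power (companion_mat r) n *v axis last_ix 1) \<le> C * \<rho> ^ n)"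
proof -
  obtain \<rho> where \<rho>: "0 < \<rho>" "\<rho> < 1" "\<And>z. poly (char_pol r) z = 0 \<Longrightarrow> norm z < \<rho>"
    using interior_srs_D_imp_roots_less_1[OF assms] by blast
  have "norm (poly (char_pol r) 0) \<le> 1"
    using \<rho> by (intro norm_poly_0_le_1 lead_coeff_char_pol) fastforce
  then show "\<bar>r $ first_ix\<bar> \<le> 1" by (simp add: poly_char_pol_0)
  obtain C where C: "\<And>n. norm (mat_power (companion_mat r) n *v axis last_ix 1) \<le> C * \<rho> ^ n"
    using companion_orbit_bound[OF \<rho>(1,3)] by blast
  have "C \<ge> 0" using order.trans[OF norm_ge_zero C[of 0]] by simp
  with C \<rho> show "\<exists>C\<ge>0. \<exists>\<rho>. 0 < \<rho> \<and> \<rho> < 1 \<and>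
      (\<forall>n. norm (mat_power (companion_mat r) n *v axis last_ix 1) \<le> C * \<rho> ^ n)"
    by blast
qed

text \<open>Applying the \<open>n\<close>-th matrix power to \<open>companion_mult_preimage\<close>
  leaves an error of a fractional part times the image of the last unit vector.\<close>

lemma dist_srs_approx_step:
  assumes "z \<in> srs_preimage r 1 y"
  shows "dist (mat_power (companion_mat r) n *v real_vec y) (mat_power (companion_mat r) (Suc n) *v real_vec z)
     \<le> norm (mat_power (companion_mat r) n *v axis last_ix 1)"
proof -
  let ?M = "mat_power (companion_mat r) n" and ?f = "frac (r \<bullet> real_vec z)"
  have "srs_map r z = y"
    using assms by (simp add: srs_preimage_def)
  then have "?M *v real_vec y - mat_power (companion_mat r) (Suc n) *v real_vec z = ?f *\<^sub>R (?M *v axis last_ix 1)"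
    by (simp add: mat_power_Suc_mult_vec companion_mult_preimage matrix_vector_mult_diff_distrib
        matrix_vector_mult_scaleR)
  moreover have "?f \<le> 1" "0 \<le> ?f"
    by (auto intro: less_imp_le frac_lt_1)
  ultimately show ?thesis
    by (simp add: dist_norm mult_left_le_one_le)
qed

text \<open>Existence of a preimage yields \<open>up\<close>, applying \<open>srs_map\<close> yields
  \<open>down\<close>, and finiteness yields compactness.\<close>

lemma geometric_sets_srs_approx:
  fixes r :: "real^('n::{finite,linorder})"
  assumes r0: "r $ first_ix \<noteq> 0" "\<bar>r $ first_ix\<bar> \<le> 1"
    and C: "0 \<le> C" "0 < \<rho>" "\<rho> < 1"
      "\<And>n. norm (mat_power (companion_mat r) n *v axis last_ix 1) \<le> C * \<rho> ^ n"
  shows "geometric_sets (srs_approx r x) C \<rho>"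
proof
  fix n
  show "compact (srs_approx r x n)"
    unfolding srs_approx_def by (intro finite_imp_compact finite_imageI finite_srs_preimage r0)
  show "srs_approx r x n \<noteq> {}"
    using srs_preimage_nonempty[OF r0] by (simp add: srs_approx_def)
  show "\<exists>b\<in>srs_approx r x (Suc n). dist a b \<le> C * \<rho> ^ n" if "a \<in> srs_approx r x n" for a
  proof -
    obtain y where y: "y \<in> srs_preimage r n x" "a = mat_power (companion_mat r) n *v real_vec y"
      using \<open>a \<in> _\<close> by (auto simp: srs_approx_def)
    obtain z where z: "z \<in> srs_preimage r 1 y"
      using srs_preimage_1_nonempty[OF r0] by blast
    have "z \<in> srs_preimage r (Suc n) x"
      using y z unfolding srs_preimage_Suc by blast
    then show ?thesis
      using order.trans[OF dist_srs_approx_step[OF z, of n] C(4)[of n]] y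
      by (auto simp: srs_approx_def)
  qed
  show "\<exists>a\<in>srs_approx r x n. dist a b \<le> C * \<rho> ^ n" if "b \<in> srs_approx r x (Suc n)" for b
  proof -
    obtain z where b: "b = mat_power (companion_mat r) (Suc n) *v real_vec z"
      and z: "z \<in> srs_preimage r (Suc n) x"
      using \<open>b \<in> _\<close> by (auto simp: srs_approx_def)
    then obtain y where y: "y \<in> srs_preimage r n x" "z \<in> srs_preimage r 1 y"
      unfolding srs_preimage_Suc by blast
    show ?thesis
      using order.trans[OF dist_srs_approx_step[OF y(2), of n] C(4)[of n]] y(1) b
      by (auto simp: srs_approx_def)
  qed
qed (use C in auto)

text \<open>Continuity pulls a neighbourhood of the image back to one of \<open>t\<close>;
  \<open>srs_approx_Suc\<close> then transfers its intersections with the approximations.\<close>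

lemma image_srs_tile_subset:
  fixes r :: "real^('n::{finite,linorder})"
  assumes "y \<in> srs_preimage r 1 x" "t \<in> srs_tile r y"
  shows "companion_mat r *v t \<in> srs_tile r x"
proof -
  have "\<forall>\<^sub>F n in sequentially. U \<inter> srs_approx r x (Suc n) \<noteq> {}"
    if U: "open U" "companion_mat r *v t \<in> U" for U
  proof -
    have "open ((\<lambda>v. companion_mat r *v v) -` U)"
      using U(1) by (intro open_vimage matrix_vector_mult_linear_continuous_on)
    then have "\<forall>\<^sub>F n in sequentially. ((\<lambda>v. companion_mat r *v v) -` U) \<inter> srs_approx r y n \<noteq> {}"
      using assms(2) U(2) by (auto simp: srs_tile_def lower_hausdorff_lim_def)
    then show ?thesis
      by eventually_elim (use assms(1) in \<open>unfold srs_approx_Suc, blast\<close>)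
  qed
  then show ?thesis
    unfolding srs_tile_def by (subst lower_hausdorff_lim_Suc[symmetric]) (auto simp: lower_hausdorff_lim_def)
qed

text \<open>The right-hand side \<open>B\<close> of the set equation is closed, and each point of the \<open>(n+1)\<close>-st
  approximation of the tile has a distance to \<open>B\<close> that is at most a constant times \<open>\<rho>\<^sup>n\<close>.\<close>
lemma srs_tile_subset_image:
  fixes r :: "real^('n::{finite,linorder})"
  assumes r0: "r $ first_ix \<noteq> 0" "\<bar>r $ first_ix\<bar> \<le> 1"
    and geo: "\<And>x. geometric_sets (srs_approx r x) C \<rho>"
  shows "srs_tile r x \<subseteq> (\<Union>y\<in>srs_preimage r 1 x. (\<lambda>t. companion_mat r *v t) ` srs_tile r y)" (is "_ \<subseteq> ?B")
proof
  fix t assume t: "t \<in> srs_tile r x"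
  interpret G: geometric_sets "srs_approx r x" C \<rho> by (rule geo)
  obtain K where K: "K > 0" "\<And>v. norm (companion_mat r *v v) \<le> norm v * K"
    using bounded_linear.pos_bounded[OF matrix_vector_mul_bounded_linear] by blast
  have compB: "compact ?B"
    using geometric_sets.compact_limit[OF geo]
    by (intro compact_UN finite_srs_preimage_1 r0 compact_continuous_image
        matrix_vector_mult_linear_continuous_on) (simp add: srs_tile_def)
  have neB: "?B \<noteq> {}"
    using srs_preimage_1_nonempty[OF r0, of x] geometric_sets.limit_nonempty[OF geo]
    unfolding srs_tile_def by fast
  \<comment> \<open>The first term leads from \<open>t\<close> to the approximation, the second from
    there to \<open>?B\<close>, with \<open>K\<close> bounding the expansion by the matrix.\<close>
  have "infdist t ?B \<le> G.tail (Suc n) + G.tail n * K" for n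
  proof -
    obtain a where a: "a \<in> srs_approx r x (Suc n)" "infdist t (srs_approx r x (Suc n)) = dist t a"
      using infdist_attains_inf compact_imp_closed[OF G.cpt] G.nonempty by metis
    then obtain y u where yu: "y \<in> srs_preimage r 1 x" "u \<in> srs_approx r y n" "a = companion_mat r *v u"
      unfolding srs_approx_Suc by blast
    \<comment> \<open>\<open>tail\<close> depends only on \<open>C\<close> and
      \<open>\<rho>\<close>, so the same function serves the approximations for
      \<open>y\<close>.\<close>
    obtain w where w: "w \<in> srs_tile r y" "dist u w \<le> G.tail n"
      using geometric_sets.ex_limit_near[OF geo yu(2)] unfolding srs_tile_def by blast
    have "companion_mat r *v w \<in> ?B"
      using w yu by blast
    then have "infdist t ?B \<le> dist t (companion_mat r *v w)"
      by (rule infdist_le)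
    also have "\<dots> \<le> dist t a + dist a (companion_mat r *v w)"
      by (rule dist_triangle)
    also have "dist t a \<le> G.tail (Suc n)"
      using G.infdist_limit_le[of t "Suc n"] t a(2) by (simp add: srs_tile_def)
    also have "dist a (companion_mat r *v w) \<le> norm (u - w) * K"
      using K(2)[of "u - w"] by (simp add: yu(3) dist_norm matrix_vector_mult_diff_distrib)
    also have "\<dots> \<le> G.tail n * K"
      using w(2) K(1) by (intro mult_right_mono) (auto simp: dist_norm)
    finally show ?thesis by simp
  qed
  moreover have "(\<lambda>n. G.tail (Suc n) + G.tail n * K) \<longlonglongrightarrow> 0 + 0 * K"
    by (intro tendsto_intros G.tail_tendsto LIMSEQ_Suc)
  ultimately have "infdist t ?B \<le> 0"
    by (intro LIMSEQ_le_const) auto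
  then have "infdist t ?B = 0"
    using infdist_nonneg[of t ?B] by linarith
  then show "t \<in> ?B"
    using in_closed_iff_infdist_zero[OF compact_imp_closed[OF compB] neB] by blast
qed

theorem theorem3p5:
  fixes r :: "real^('n::{finite,linorder})" and x :: "int^('n::{finite,linorder})"
  assumes "r \<in> interior srs_D"
    and "r $ first_ix \<noteq> 0"
  shows "has_hausdorff_lim (srs_approx r x) (srs_tile r x)
       \<and> srs_tile r x \<noteq> {} \<and> compact (srs_tile r x)
       \<and> srs_tile r x = (\<Union>y\<in>srs_preimage r 1 x. (\<lambda>t. companion_mat r *v t) ` srs_tile r y)"
proof -
  obtain C \<rho> where C: "0 \<le> C" "0 < \<rho>" "\<rho> < 1"
      "\<And>n. norm (mat_power (companion_mat r) n *v axis last_ix 1) \<le> C * \<rho> ^ n"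
    using interior_srs_D_contraction(2)[OF assms(1)] by blast
  note r0 = assms(2) interior_srs_D_contraction(1)[OF assms(1)]
  \<comment> \<open>The constants are independent of the starting point, so one pair serves
    \<open>x\<close> and all its preimages.\<close>
  have geo: "geometric_sets (srs_approx r x) C \<rho>" for x
    by (rule geometric_sets_srs_approx[OF r0 C])
  have "srs_tile r x = (\<Union>y\<in>srs_preimage r 1 x. (\<lambda>t. companion_mat r *v t) ` srs_tile r y)"
    by (rule equalityI[OF srs_tile_subset_image[OF r0 geo]]) (use image_srs_tile_subset in blast)
  moreover have "has_hausdorff_lim (srs_approx r x) (srs_tile r x)"
    unfolding srs_tile_def by (rule geometric_sets.has_hausdorff_lim_limit[OF geo])
  moreover from this have "srs_tile r x \<noteq> {}" "compact (srs_tile r x)"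
    by (auto simp: has_hausdorff_lim_def)
  ultimately show ?thesis by blast
qed

end
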